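(* Let $B\ge 1$ be an integer, let $\theta$ be a parameter, and let $L_1(\theta),\dots,L_B(\theta)\in\mathbb{R}$ be the group losses. For any $\eta>0$, define $$\mathcal{R}_{\eta}(\theta)\;=\;\max_{q\in\Delta_B}\left\{\sum_{b=1}^{B} q(b)L_b(\theta)+\frac{1}{\eta}H(q)\right\},\qquad H(q)=-\sum_{b=1}^{B} q(b)\log q(b).$$ Then $$\mathcal{R}_{\eta}(\theta)=\frac{1}{\eta}\log\!\left(\sum_{b=1}^{B} e^{\eta L_b(\theta)}\right),$$ and the unique maximizer is the softmax distribution $$q_{\eta}(b;\theta)=\frac{\exp(\eta L_b(\theta))}{\sum_{j=1}^{B} \exp(\eta L_j(\theta))},\qquad b=1,\dots,B.$$ Moreover, $$\max_{b\in\{1,\dots,B\}} L_b(\theta)\;\le\;\mathcal{R}_\eta(\theta)\;\le\;\max_{b\in\{1,\dots,B\}} L_b(\theta)+\frac{\log B}{\eta}.$$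
   Context: $\Delta_B=\{q\in\mathbb{R}^B: q(b)\ge 0,\ \sum_b q(b)=1\}$ is the probability simplex. In the entropy, $0\log 0=0$. The group loss $L_b(\theta)$ is a real number, namely the expected loss $\mathbb{E}[\ell(x;\theta)\mid g(x)=b]$ of a prompt $x$ in group $b$, where $g$ is a fixed grouping map into $\{1,\dots,B\}$ and $\ell(x;\theta)$ is a real-valued loss. *)

theory Defs
  imports Complex_Main "HOL-Library.FuncSet"
begin

text \<open>
  A vector in \<open>\<real>\<^sup>B\<close> is a function on \<open>{1..B}\<close>, represented by a function on \<^typ>\<open>nat\<close> that is
  \<^const>\<open>undefined\<close> outside \<open>{1..B}\<close>, so that equality of functions is equality of vectors.
\<close>

definition prob_simplex :: "nat \<Rightarrow> (nat \<Rightarrow> real) set" where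
  "prob_simplex B = {q \<in> extensional {1..B}. (\<forall>b\<in>{1..B}. 0 \<le> q b) \<and> (\<Sum>b=1..B. q b) = 1}"

text \<open>The convention \<open>0 log 0 = 0\<close> holds because the factor \<open>q b = 0\<close> annihilates \<open>ln 0\<close>.\<close>

definition entropy :: "nat \<Rightarrow> (nat \<Rightarrow> real) \<Rightarrow> real" where
  "entropy B q = - (\<Sum>b=1..B. q b * ln (q b))"

definition entropic_objective ::
  "nat \<Rightarrow> real \<Rightarrow> ('p \<Rightarrow> nat \<Rightarrow> real) \<Rightarrow> 'p \<Rightarrow> (nat \<Rightarrow> real) \<Rightarrow> real" where
  "entropic_objective B \<eta> L \<theta> q = (\<Sum>b=1..B. q b * L \<theta> b) + 1 / \<eta> * entropy B q"

text \<open>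
  A maximum, not a supremum: \<^const>\<open>Greatest\<close> is specified only if the set of values
  has a greatest element.
\<close>

definition entropic_risk :: "nat \<Rightarrow> real \<Rightarrow> ('p \<Rightarrow> nat \<Rightarrow> real) \<Rightarrow> 'p \<Rightarrow> real" where
  "entropic_risk B \<eta> L \<theta> =
     (GREATEST v. v \<in> entropic_objective B \<eta> L \<theta> ` prob_simplex B)"

definition softmax :: "nat \<Rightarrow> real \<Rightarrow> ('p \<Rightarrow> nat \<Rightarrow> real) \<Rightarrow> 'p \<Rightarrow> nat \<Rightarrow> real" where
  "softmax B \<eta> L \<theta> =
     (\<lambda>b\<in>{1..B}. exp (\<eta> * L \<theta> b) / (\<Sum>j=1..B. exp (\<eta> * L \<theta> j)))"

end

theory Submission
  imports Defs
begin

text \<open>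
  Since \<open>\<eta> L\<^sub>b = ln p\<^sub>b + ln Z\<close> for the softmax \<open>p\<close> with normalising constant \<open>Z\<close>, the objective
  at \<open>q\<close> is \<open>(ln Z - D(q, p)) / \<eta>\<close> with \<open>D\<close> the relative entropy, and Gibbs' inequality says
  that \<open>D(q, p)\<close> is nonnegative and vanishes only at \<open>q = p\<close>. The bounds follow from
  \<open>exp (\<eta> max L) \<le> Z \<le> B exp (\<eta> max L)\<close>.
\<close>

text \<open>This is the tangent bound \<open>ln x \<le> x - 1\<close> at \<open>x = p / q\<close>,
  multiplied by \<open>q\<close>. For \<open>q = 0\<close> both products vanish and only
  \<open>0 < p\<close> remains.\<close>

lemma mult_ln_diff_less:
  fixes p q :: real
  assumes "p > 0" "q \<ge> 0" "q \<noteq> p"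
  shows "q * ln p - q * ln q < p - q"
proof (cases "q = 0")
  case True
  then show ?thesis using assms by simp
next
  case False
  with assms have q: "q > 0" by simp
  \<comment> \<open>The tangent touches the logarithm only at \<open>1\<close>, and
    \<open>p / q = 1\<close> would give \<open>q = p\<close>.\<close>
  have "ln (p / q) \<noteq> p / q - 1"
    using ln_eq_minus_one[of "p / q"] assms q by auto
  with ln_le_minus_one[of "p / q"] assms q have "ln (p / q) < p / q - 1"
    by (simp add: less_le)
  with q have "q * ln (p / q) < q * (p / q - 1)"
    by (rule mult_strict_left_mono[rotated])
  with assms q show ?thesis by (simp add: ln_div algebra_simps)
qed

text \<open>Summing the pointwise bounds leaves the difference of the two totals on the right, which
  is zero. One index with a strict bound makes the whole sum strict.\<close>

lemma gibbs_inequality_strict: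
  fixes p q :: "'a \<Rightarrow> real"
  assumes "finite A" "\<And>a. a \<in> A \<Longrightarrow> p a > 0" "\<And>a. a \<in> A \<Longrightarrow> q a \<ge> 0"
    and "sum q A = sum p A" "\<exists>a\<in>A. q a \<noteq> p a"
  shows "(\<Sum>a\<in>A. q a * ln (p a) - q a * ln (q a)) < 0"
proof -
  have "(\<Sum>a\<in>A. q a * ln (p a) - q a * ln (q a)) < (\<Sum>a\<in>A. p a - q a)"
  proof (rule sum_strict_mono_ex1)
    \<comment> \<open>Where \<open>q a = p a\<close> both sides are zero; elsewhere the strict bound
      applies.\<close>
    show "\<forall>a\<in>A. q a * ln (p a) - q a * ln (q a) \<le> p a - q a"
    proof
      fix a assume "a \<in> A"
      then show "q a * ln (p a) - q a * ln (q a) \<le> p a - q a"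
        using mult_ln_diff_less[of "p a" "q a"] assms(2,3) by (cases "q a = p a") auto
    qed
    show "\<exists>a\<in>A. q a * ln (p a) - q a * ln (q a) < p a - q a"
      using mult_ln_diff_less assms(2,3,5) by blast
  qed (fact assms(1))
  with assms(4) show ?thesis by (simp add: sum_subtractf)
qed

lemma sum_exp_pos:
  fixes f :: "nat \<Rightarrow> real"
  assumes "B \<ge> 1"
  shows "(\<Sum>b=1..B. exp (f b)) > 0"
  using assms by (intro sum_pos) auto

lemma softmax_in_prob_simplex:
  assumes "B \<ge> 1"
  shows "softmax B \<eta> L \<theta> \<in> prob_simplex B"
  using sum_exp_pos[OF assms, of "\<lambda>b. \<eta> * L \<theta> b"]
  by (auto simp: softmax_def prob_simplex_def simp flip: sum_divide_distrib)

lemma entropic_objective_eq_relative_entropy: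
  assumes "B \<ge> 1" "\<eta> > 0" "q \<in> prob_simplex B"
  shows "entropic_objective B \<eta> L \<theta> q = 1 / \<eta> * (ln (\<Sum>b=1..B. exp (\<eta> * L \<theta> b))
    + (\<Sum>b=1..B. q b * ln (softmax B \<eta> L \<theta> b) - q b * ln (q b)))"
proof -
  define Z where "Z = (\<Sum>b=1..B. exp (\<eta> * L \<theta> b))"
  have Z: "Z > 0" unfolding Z_def using assms(1) by (rule sum_exp_pos)
  have "(\<Sum>b=1..B. q b * ln (softmax B \<eta> L \<theta> b)) = (\<Sum>b=1..B. \<eta> * (q b * L \<theta> b) - q b * ln Z)"
  proof (rule sum.cong[OF refl])
    fix b assume "b \<in> {1..B}"
    then have "softmax B \<eta> L \<theta> b = exp (\<eta> * L \<theta> b) / Z"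
      by (simp add: softmax_def Z_def)
    with Z show "q b * ln (softmax B \<eta> L \<theta> b) = \<eta> * (q b * L \<theta> b) - q b * ln Z"
      by (simp add: ln_div algebra_simps)
  qed
  \<comment> \<open>The weights \<open>q b\<close> sum to \<open>1\<close>, so \<open>ln Z\<close>
    comes out with coefficient one.\<close>
  also have "\<dots> = \<eta> * (\<Sum>b=1..B. q b * L \<theta> b) - ln Z"
    using assms(3) by (simp add: prob_simplex_def sum_subtractf sum_distrib_left
        flip: sum_distrib_right)
  finally show ?thesis
    using assms(2) unfolding entropic_objective_def entropy_def Z_def[symmetric]
    by (simp add: sum_subtractf field_simps)
qed

lemma entropic_objective_softmax:
  assumes "B \<ge> 1" "\<eta> > 0"
  shows "entropic_objective B \<eta> L \<theta> (softmax B \<eta> L \<theta>) = 1 / \<eta> * ln (\<Sum>b=1..B. exp (\<eta> * L \<theta> b))"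
  by (simp add: entropic_objective_eq_relative_entropy[OF assms softmax_in_prob_simplex[OF assms(1)]])

lemma entropic_objective_less_softmax:
  assumes "B \<ge> 1" "\<eta> > 0" "q \<in> prob_simplex B" "q \<noteq> softmax B \<eta> L \<theta>"
  shows "entropic_objective B \<eta> L \<theta> q < entropic_objective B \<eta> L \<theta> (softmax B \<eta> L \<theta>)"
proof -
  let ?p = "softmax B \<eta> L \<theta>"
  have p: "?p \<in> prob_simplex B" using assms(1) by (rule softmax_in_prob_simplex)
  \<comment> \<open>Both functions are extensional on \<open>{1..B}\<close>, so they can differ only
    at an index in that range.\<close>
  have "\<exists>b\<in>{1..B}. q b \<noteq> ?p b"
    using assms(3,4) p unfolding prob_simplex_def by (blast intro: extensionalityI)
  moreover have "?p b > 0" if "b \<in> {1..B}" for b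
    using that sum_exp_pos[OF assms(1), of "\<lambda>b. \<eta> * L \<theta> b"] by (simp add: softmax_def)
  ultimately have "(\<Sum>b=1..B. q b * ln (?p b) - q b * ln (q b)) < 0"
    using assms(3) p by (intro gibbs_inequality_strict) (auto simp: prob_simplex_def)
  then show ?thesis
    unfolding entropic_objective_softmax[OF assms(1,2)]
      entropic_objective_eq_relative_entropy[OF assms(1-3)]
    using assms(2) by (intro mult_strict_left_mono) auto
qed

text \<open>\<open>is_arg_max\<close> asks only that no point of the simplex be strictly better.
  Since softmax strictly beats every other point, it is a maximizer and every other point fails to
  be one.\<close>

lemma is_arg_max_entropic_objective_iff:
  assumes "B \<ge> 1" "\<eta> > 0"
  shows "is_arg_max (entropic_objective B \<eta> L \<theta>) (\<lambda>q. q \<in> prob_simplex B) q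
    \<longleftrightarrow> q = softmax B \<eta> L \<theta>"
  using softmax_in_prob_simplex[OF assms(1), of \<eta> L \<theta>]
    entropic_objective_less_softmax[OF assms, of _ L \<theta>]
  unfolding is_arg_max_def by (metis less_asym)

lemma entropic_risk_eq:
  assumes "B \<ge> 1" "\<eta> > 0"
  shows "entropic_risk B \<eta> L \<theta> = 1 / \<eta> * ln (\<Sum>b=1..B. exp (\<eta> * L \<theta> b))"
  \<comment> \<open>The closed form is turned back into the objective at softmax, which exhibits it
    as an attained value.\<close>
  unfolding entropic_risk_def entropic_objective_softmax[OF assms, symmetric]
proof (rule Greatest_equality)
  show "entropic_objective B \<eta> L \<theta> (softmax B \<eta> L \<theta>)
      \<in> entropic_objective B \<eta> L \<theta> ` prob_simplex B"
    using softmax_in_prob_simplex[OF assms(1)] by (rule imageI)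
next
  fix v assume "v \<in> entropic_objective B \<eta> L \<theta> ` prob_simplex B"
  then show "v \<le> entropic_objective B \<eta> L \<theta> (softmax B \<eta> L \<theta>)"
    using entropic_objective_less_softmax[OF assms] by (metis imageE less_imp_le order_refl)
qed

lemma ln_sum_exp_bounds:
  fixes f :: "nat \<Rightarrow> real"
  assumes "B \<ge> 1" "\<eta> > 0"
  shows "(MAX b\<in>{1..B}. f b) \<le> 1 / \<eta> * ln (\<Sum>b=1..B. exp (\<eta> * f b))"
    and "1 / \<eta> * ln (\<Sum>b=1..B. exp (\<eta> * f b)) \<le> (MAX b\<in>{1..B}. f b) + ln (real B) / \<eta>"
proof -
  define M where "M = (MAX b\<in>{1..B}. f b)"
  define Z where "Z = (\<Sum>b=1..B. exp (\<eta> * f b))"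
  have Z: "Z > 0" unfolding Z_def using assms(1) by (rule sum_exp_pos)
  \<comment> \<open>The index set is nonempty because \<open>B \<ge> 1\<close>, so the maximum is
    attained.\<close>
  have "M \<in> f ` {1..B}"
    unfolding M_def using assms(1) by (intro Max_in) auto
  then obtain m where m: "m \<in> {1..B}" "M = f m" by blast
  \<comment> \<open>The summand at the maximizing index \<open>m\<close> is at most the whole sum,
    all terms being positive.\<close>
  have "exp (\<eta> * M) \<le> Z"
    unfolding Z_def m(2) using m(1) by (intro member_le_sum) auto
  then have "\<eta> * M \<le> ln Z" using Z by (simp add: ln_ge_iff)
  then show "(MAX b\<in>{1..B}. f b) \<le> 1 / \<eta> * ln (\<Sum>b=1..B. exp (\<eta> * f b))"
    using assms(2) unfolding M_def[symmetric] Z_def[symmetric] by (simp add: field_simps)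
  \<comment> \<open>As \<open>\<eta> > 0\<close>, scaling keeps the order, so each of the
    \<open>B\<close> summands is at most the largest one.\<close>
  have "exp (\<eta> * f b) \<le> exp (\<eta> * M)" if "b \<in> {1..B}" for b
    using that assms(2) by (simp add: M_def)
  then have "Z \<le> real B * exp (\<eta> * M)"
    unfolding Z_def using sum_bounded_above[of "{1..B}" "\<lambda>b. exp (\<eta> * f b)"] by simp
  then have "ln Z \<le> ln (real B * exp (\<eta> * M))"
    using Z by simp
  also have "\<dots> = ln (real B) + \<eta> * M"
    using assms(1) by (simp add: ln_mult)
  finally show "1 / \<eta> * ln (\<Sum>b=1..B. exp (\<eta> * f b)) \<le> (MAX b\<in>{1..B}. f b) + ln (real B) / \<eta>"
    using assms(2) unfolding M_def[symmetric] Z_def[symmetric] by (simp add: field_simps)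
qed

theorem lemma4p1:
  fixes B :: nat and \<eta> :: real and \<theta> :: 'p and L :: "'p \<Rightarrow> nat \<Rightarrow> real"
  assumes "B \<ge> 1" and "\<eta> > 0"
  shows "entropic_risk B \<eta> L \<theta> = 1 / \<eta> * ln (\<Sum>b=1..B. exp (\<eta> * L \<theta> b))
    \<and> (\<forall>q. is_arg_max (entropic_objective B \<eta> L \<theta>) (\<lambda>q. q \<in> prob_simplex B) q
           \<longleftrightarrow> q = softmax B \<eta> L \<theta>)
    \<and> (MAX b\<in>{1..B}. L \<theta> b) \<le> entropic_risk B \<eta> L \<theta>
    \<and> entropic_risk B \<eta> L \<theta> \<le> (MAX b\<in>{1..B}. L \<theta> b) + ln (real B) / \<eta>"
  unfolding entropic_risk_eq[OF assms] is_arg_max_entropic_objective_iff[OF assms]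
  by (intro conjI allI refl ln_sum_exp_bounds[OF assms])

end
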